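(* Let $\mathsf{ALG}$ be an online algorithm for an online covering problem with competitive ratio $\rho(k,\cdot)$, where $k$ is the number of arriving requests. Then, given a prediction $\hat{X}$ of the set of requests (available before the first request arrives), there exists an online algorithm with competitive ratio $O(\rho(\eta,\cdot))$, where $\eta=\min(|X|,|X\triangle\hat{X}|)$ is the prediction error and $X$ is the set of actually arriving requests.
   Context: An online covering problem consists of a set of potential requests, a set of resources each with a nonnegative cost (the cost $c(\mathcal{S})$ of a set $\mathcal{S}$ of resources is the sum of their costs), and a feasibility relation saying which sets of resources are feasible (i.e. serve/cover) a given set of requests, satisfying the covering property: if $\mathcal{S}_1$ is feasible for $X_1$ and $\mathcal{S}_2$ is feasible for $X_2$, then $\mathcal{S}_1\cup\mathcal{S}_2$ is feasible for $X_1\cup X_2$. Requests of a set $X$ arrive one by one; after each arrival an online algorithm must irrevocably buy resources so that the set of resources bought so far is feasible for all requests arrived so far. $\mathsf{opt}$ denotes the minimum cost of a solution feasible for $X$. An online algorithm is $\rho$-competitive if for every input its cost (expected cost, for randomized algorithms) is at most $\rho\cdot\mathsf{opt}$; a competitive ratio $\rho(k,\cdot)$ may depend on $k=|X|$ and possibly on other parameters of the instance (denoted $\cdot$). In the learning-augmented setting, the algorithm additionally receives beforehand a predicted set of requests $\hat{X}$, and the prediction error is $\eta:=\min(|X|,|X\triangle\hat{X}|)$ where $X\triangle\hat{X}=(X\setminus\hat{X})\cup(\hat{X}\setminus X)$.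
   Formalization: Assumed in addition: a set of resources feasible for a set of requests is feasible for each of its subsets, and ρ(0,·) ≥ 1 (the claim fails without either); solutions are finite and a randomized algorithm's purchases take countably many values. *)

theory Defs
  imports "HOL-Probability.Probability"
begin

text \<open>
  One structure of an online covering problem. Solutions are finite sets of resources, so that
  their cost is a finite sum; the resource set itself may be infinite.
\<close>

record ('r, 's) covering =
  requests :: "'r set"
  resources :: "'s set"
  price :: "'s \<Rightarrow> real"
  feasible :: "'s set \<Rightarrow> 'r set \<Rightarrow> bool"

definition cost :: "('r, 's) covering \<Rightarrow> 's set \<Rightarrow> real" where
  "cost P S = (\<Sum>s\<in>S. price P s)"

definition solutions :: "('r, 's) covering \<Rightarrow> 'r set \<Rightarrow> 's set set" where
  "solutions P X = {S. finite S \<and> S \<subseteq> resources P \<and> feasible P S X}"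

text \<open>
  The last condition says that a solution serving a set of requests also serves every subset of
  it. It is part of the meaning of serving a set of requests, but does not follow from the
  covering property.
\<close>

definition covering_problem :: "('r, 's) covering \<Rightarrow> bool" where
  "covering_problem P \<longleftrightarrow>
     (\<forall>s\<in>resources P. 0 \<le> price P s) \<and>
     (\<forall>X1 X2 S1 S2. finite X1 \<longrightarrow> X1 \<subseteq> requests P \<longrightarrow> finite X2 \<longrightarrow> X2 \<subseteq> requests P \<longrightarrow>
        S1 \<in> solutions P X1 \<longrightarrow> S2 \<in> solutions P X2 \<longrightarrow> feasible P (S1 \<union> S2) (X1 \<union> X2)) \<and>
     (\<forall>X Y S. finite X \<longrightarrow> X \<subseteq> requests P \<longrightarrow> Y \<subseteq> X \<longrightarrow> S \<in> solutions P X \<longrightarrow> feasible P S Y)"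

text \<open>
  The infimum is the minimum whenever the latter exists, e.g. if there are finitely many resources.
\<close>

definition opt :: "('r, 's) covering \<Rightarrow> 'r set \<Rightarrow> real" where
  "opt P X = Inf (cost P ` solutions P X)"

text \<open>
  The requests of a set arrive one by one, hence without repetitions. As every prefix of an
  arrival sequence is again one, conditions on all arrival sequences hold at every point in time.
\<close>

definition arrivals :: "('r, 's) covering \<Rightarrow> 'r list set" where
  "arrivals P = {xs. distinct xs \<and> set xs \<subseteq> requests P}"

text \<open>
  \<open>bought A \<omega> xs\<close> is the set of all resources bought so far when the random seed is \<open>\<omega>\<close> and
  exactly the requests \<open>xs\<close> have arrived, in this order. The algorithm is online because this
  set is a function of the requests arrived so far; decisions are irrevocable because the set
  only grows. The seed does not depend on the requests (oblivious adversary).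
\<close>

record ('w, 'r, 's) algorithm =
  seed :: "'w measure"
  bought :: "'w \<Rightarrow> 'r list \<Rightarrow> 's set"

text \<open>
  The purchases are discrete random variables. Countability of the range is automatic when
  there are countably many resources.
\<close>

definition online_algorithm ::
    "('r, 's) covering \<Rightarrow> ('w, 'r, 's) algorithm \<Rightarrow> bool" where
  "online_algorithm P A \<longleftrightarrow>
     prob_space (seed A) \<and>
     (\<forall>xs\<in>arrivals P.
        (\<lambda>\<omega>. bought A \<omega> xs) \<in> measurable (seed A) (count_space UNIV) \<and>
        countable ((\<lambda>\<omega>. bought A \<omega> xs) ` space (seed A))) \<and>
     (\<forall>\<omega>\<in>space (seed A). \<forall>xs\<in>arrivals P. bought A \<omega> xs \<in> solutions P (set xs)) \<and>
     (\<forall>\<omega>\<in>space (seed A). \<forall>xs x. xs @ [x] \<in> arrivals P \<longrightarrow>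
        bought A \<omega> xs \<subseteq> bought A \<omega> (xs @ [x]))"

definition deterministic ::
    "('r, 's) covering \<Rightarrow> ('w, 'r, 's) algorithm \<Rightarrow> bool" where
  "deterministic P A \<longleftrightarrow>
     (\<forall>\<omega>\<in>space (seed A). \<forall>\<omega>'\<in>space (seed A). \<forall>xs\<in>arrivals P. bought A \<omega> xs = bought A \<omega>' xs)"

text \<open>
  The ratio \<open>r\<close> may depend on the set of requests that actually arrive. For deterministic
  algorithms the expectation is just the cost of the set bought.
\<close>

definition competitive ::
    "('r, 's) covering \<Rightarrow> ('w, 'r, 's) algorithm \<Rightarrow> ('r set \<Rightarrow> real) \<Rightarrow> bool" where
  "competitive P A r \<longleftrightarrow>
     (\<forall>xs\<in>arrivals P.
        integrable (seed A) (\<lambda>\<omega>. cost P (bought A \<omega> xs)) \<and>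
        prob_space.expectation (seed A) (\<lambda>\<omega>. cost P (bought A \<omega> xs))
          \<le> r (set xs) * opt P (set xs))"

definition prediction_error :: "'r set \<Rightarrow> 'r set \<Rightarrow> nat" where
  "prediction_error X Xhat = min (card X) (card ((X - Xhat) \<union> (Xhat - X)))"

end

theory Submission
  imports Defs
begin

text \<open>
  The given algorithm is run in phases. Each phase has a budget; it starts with the purchase of a
  solution within the budget that serves as many predicted requests as possible, and restarts the
  given algorithm on the requests not served by it. When the expected cost of this run is about to
  exceed the budget \<open>B\<close>, the budget is at least doubled, to \<open>2 max(B, opt)\<close> for the current
  optimum, and a nearly optimal solution for all requests seen so far is bought. The total cost is
  geometric, hence at most a constant times the last budget. A phase with \<open>B \<ge> 2 opt(X)\<close> leaves at
  most \<open>|Xhat - X|\<close> predicted requests unserved, so its run has at most \<open>\<eta>\<close> requests, all from \<open>X\<close>,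
  and it can exceed \<open>B\<close> only if \<open>B < \<rho>(\<eta>) opt(X)\<close>.
\<close>

section \<open>The algorithm with prediction\<close>

definition expected_cost ::
    "('r, 's) covering \<Rightarrow> ('w, 'r, 's) algorithm \<Rightarrow> 'r list \<Rightarrow> real" where
  "expected_cost P A xs = prob_space.expectation (seed A) (\<lambda>\<omega>. cost P (bought A \<omega> xs))"

text \<open>The infimum in \<^const>\<open>opt\<close> need not be attained, hence the factor 2.\<close>

definition near_opt :: "('r, 's) covering \<Rightarrow> 'r set \<Rightarrow> 's set" where
  "near_opt P X = (SOME S. S \<in> solutions P X \<and> cost P S \<le> 2 * opt P X)"

definition affordable :: "('r, 's) covering \<Rightarrow> 'r set \<Rightarrow> real \<Rightarrow> 'r set \<times> 's set \<Rightarrow> bool" where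
  "affordable P X B TH \<longleftrightarrow> fst TH \<subseteq> X \<and> snd TH \<in> solutions P (fst TH) \<and> cost P (snd TH) \<le> B"

text \<open>Coverage is maximised by cardinality because only the number of predicted requests left
  over enters the error.\<close>

definition partial_cover :: "('r, 's) covering \<Rightarrow> 'r set \<Rightarrow> real \<Rightarrow> 'r set \<times> 's set" where
  "partial_cover P X B = (SOME TH. affordable P X B TH \<and>
     (\<forall>TH'. affordable P X B TH' \<longrightarrow> card (fst TH') \<le> card (fst TH)))"

text \<open>The state does not depend on the seed: phases end by expected cost, and runs are stored
  as lists of requests rather than as purchases.\<close>

record ('r, 's) state =
  budget :: real
  covered :: "'r set"
  offline :: "'s set"
  past :: "'r list list"
  current :: "'r list"

text \<open>The empty run may already cost something. Twice its expected cost is at least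
  \<open>2 * opt P {}\<close>, which guarantees that a partial cover is affordable even if the
  infimum is not attained.\<close>

definition initial ::
    "('r, 's) covering \<Rightarrow> ('w, 'r, 's) algorithm \<Rightarrow> 'r set \<Rightarrow> ('r, 's) state" where
  "initial P A Xhat = (let B = 2 * expected_cost P A []; TH = partial_cover P Xhat B in
     \<lparr>budget = B, covered = fst TH, offline = snd TH, past = [], current = []\<rparr>)"

text \<open>The request that ends the phase never enters the old run; \<open>near_opt P Y\<close>
  serves it. The closed run stays in \<open>past\<close> since its purchases are
  irrevocable.\<close>

definition new_phase ::
    "('r, 's) covering \<Rightarrow> 'r set \<Rightarrow> 'r set \<Rightarrow> ('r, 's) state \<Rightarrow> ('r, 's) state" where
  "new_phase P Xhat Y st =
     (let B = 2 * max (budget st) (opt P Y); TH = partial_cover P Xhat B in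
       \<lparr>budget = B, covered = fst TH, offline = offline st \<union> near_opt P Y \<union> snd TH,
        past = current st # past st, current = []\<rparr>)"

text \<open>The most recent request comes first in the last argument.\<close>

fun state_after ::
    "('r, 's) covering \<Rightarrow> ('w, 'r, 's) algorithm \<Rightarrow> 'r set \<Rightarrow> 'r list \<Rightarrow> ('r, 's) state" where
  "state_after P A Xhat [] = initial P A Xhat"
| "state_after P A Xhat (x # rs) = (let st = state_after P A Xhat rs in
     if x \<in> covered st then st
     else if expected_cost P A (current st @ [x]) \<le> budget st
     then st\<lparr>current := current st @ [x]\<rparr>
     else new_phase P Xhat (set (x # rs)) st)"

definition purchases ::
    "('w, 'r, 's) algorithm \<Rightarrow> 'w \<Rightarrow> ('r, 's) state \<Rightarrow> 's set" where
  "purchases A \<omega> st = offline st \<union> (\<Union>zs\<in>set (current st # past st). bought A \<omega> zs)"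

definition with_prediction ::
    "('r, 's) covering \<Rightarrow> ('w, 'r, 's) algorithm \<Rightarrow> 'r set \<Rightarrow> ('w, 'r, 's) algorithm" where
  "with_prediction P A Xhat =
     \<lparr>seed = seed A, bought = (\<lambda>\<omega> xs. purchases A \<omega> (state_after P A Xhat (rev xs)))\<rparr>"

lemma prediction_error_le_card: "prediction_error X Xhat \<le> card X"
  by (simp add: prediction_error_def)

section \<open>Costs and optima of a covering problem\<close>

locale covering_instance =
  fixes P :: "('r, 's) covering"
  assumes covering: "covering_problem P"
begin

lemma price_nonneg: "s \<in> resources P \<Longrightarrow> 0 \<le> price P s"
  using covering by (simp add: covering_problem_def)

lemma solutions_Un:
  assumes "S1 \<in> solutions P X1" "S2 \<in> solutions P X2"
    and "finite X1" "X1 \<subseteq> requests P" "finite X2" "X2 \<subseteq> requests P"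
  shows "S1 \<union> S2 \<in> solutions P (X1 \<union> X2)"
proof -
  have "feasible P (S1 \<union> S2) (X1 \<union> X2)"
    using covering assms unfolding covering_problem_def by blast
  then show ?thesis using assms by (auto simp: solutions_def)
qed

lemma solutions_antimono:
  assumes "S \<in> solutions P X" "Y \<subseteq> X" "finite X" "X \<subseteq> requests P"
  shows "S \<in> solutions P Y"
proof -
  have "feasible P S Y"
    using covering assms unfolding covering_problem_def by blast
  then show ?thesis using assms by (auto simp: solutions_def)
qed

lemma cost_nonneg: "S \<in> solutions P X \<Longrightarrow> 0 \<le> cost P S"
  unfolding cost_def by (rule sum_nonneg) (auto simp: solutions_def intro: price_nonneg)

lemma cost_mono: "S \<subseteq> T \<Longrightarrow> T \<in> solutions P X \<Longrightarrow> cost P S \<le> cost P T"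
  unfolding cost_def by (rule sum_mono2) (auto simp: solutions_def intro: price_nonneg)

lemma cost_Un_le:
  assumes "S \<in> solutions P X" "T \<in> solutions P Y"
  shows "cost P (S \<union> T) \<le> cost P S + cost P T"
proof -
  have "0 \<le> sum (price P) (S \<inter> T)"
    using assms by (intro sum_nonneg) (auto simp: solutions_def intro: price_nonneg)
  moreover have "sum (price P) (S \<union> T) = sum (price P) S + sum (price P) T - sum (price P) (S \<inter> T)"
    using assms by (intro sum_Un) (auto simp: solutions_def)
  ultimately show ?thesis by (simp add: cost_def)
qed

lemma opt_le: "S \<in> solutions P X \<Longrightarrow> opt P X \<le> cost P S"
  unfolding opt_def by (rule cInf_lower) (auto intro!: bdd_belowI[of _ 0] cost_nonneg)

lemma opt_mono:
  assumes "Y \<subseteq> X" "finite X" "X \<subseteq> requests P" "solutions P X \<noteq> {}"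
  shows "opt P Y \<le> opt P X"
  unfolding opt_def
proof (rule cInf_superset_mono)
  show "bdd_below (cost P ` solutions P Y)"
    by (auto intro!: bdd_belowI[of _ 0] cost_nonneg)
qed (use assms in \<open>auto intro: solutions_antimono\<close>)

lemma zero_cost_solution_if_singletons:
  assumes "finite X" "X \<subseteq> requests P"
    and "\<exists>S\<in>solutions P {}. cost P S = 0"
    and "\<And>x. x \<in> X \<Longrightarrow> \<exists>S\<in>solutions P {x}. cost P S = 0"
  shows "\<exists>S\<in>solutions P X. cost P S = 0"
  using assms(1,2,4)
proof (induction X)
  case empty
  then show ?case using assms(3) by simp
next
  case (insert x X)
  obtain S T where S: "S \<in> solutions P {x}" "cost P S = 0"
    and T: "T \<in> solutions P X" "cost P T = 0"
    using insert by (meson insertI1 insertI2 insert_subset)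
  have "S \<union> T \<in> solutions P ({x} \<union> X)"
    by (rule solutions_Un) (use S T insert in auto)
  moreover have "cost P (S \<union> T) \<le> 0" using cost_Un_le[OF S(1) T(1)] S T by simp
  ultimately show ?case using cost_nonneg by force
qed

end

section \<open>Expected cost and ratio of the given algorithm\<close>

locale competitive_instance = covering_instance P
  for P :: "('r, 's) covering" +
  fixes A :: "('w, 'r, 's) algorithm" and \<rho> :: "nat \<Rightarrow> real"
  assumes online: "online_algorithm P A"
    and ratio: "competitive P A (\<lambda>X. \<rho> (card X))"
    and ratio_0: "1 \<le> \<rho> 0"
begin

sublocale prob_space "seed A"
  using online by (simp add: online_algorithm_def)

lemma bought_solution:
  "\<omega> \<in> space (seed A) \<Longrightarrow> xs \<in> arrivals P \<Longrightarrow> bought A \<omega> xs \<in> solutions P (set xs)"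
  using online by (simp add: online_algorithm_def)

lemma bought_snoc: "\<omega> \<in> space (seed A) \<Longrightarrow> xs @ [x] \<in> arrivals P \<Longrightarrow>
    bought A \<omega> xs \<subseteq> bought A \<omega> (xs @ [x])"
  using online by (simp add: online_algorithm_def)

lemma bought_measurable: "xs \<in> arrivals P \<Longrightarrow>
    (\<lambda>\<omega>. bought A \<omega> xs) \<in> measurable (seed A) (count_space UNIV)"
  using online by (simp add: online_algorithm_def)

lemma bought_countable: "xs \<in> arrivals P \<Longrightarrow>
    countable ((\<lambda>\<omega>. bought A \<omega> xs) ` space (seed A))"
  using online by (simp add: online_algorithm_def)

lemma integrable_cost: "xs \<in> arrivals P \<Longrightarrow>
    integrable (seed A) (\<lambda>\<omega>. cost P (bought A \<omega> xs))"
  using ratio by (simp add: competitive_def)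

lemma expected_cost_le: "xs \<in> arrivals P \<Longrightarrow>
    expected_cost P A xs \<le> \<rho> (card (set xs)) * opt P (set xs)"
  using ratio by (simp add: competitive_def expected_cost_def)

lemma expected_cost_ge:
  assumes "xs \<in> arrivals P"
  shows "opt P (set xs) \<le> expected_cost P A xs"
  unfolding expected_cost_def
  by (rule integral_ge_const)
    (use assms in \<open>auto intro!: AE_I2 integrable_cost opt_le bought_solution\<close>)

lemma bought_append: "\<omega> \<in> space (seed A) \<Longrightarrow> xs @ ys \<in> arrivals P \<Longrightarrow>
    bought A \<omega> xs \<subseteq> bought A \<omega> (xs @ ys)"
proof (induction ys rule: rev_induct)
  case (snoc y ys)
  then have "bought A \<omega> xs \<subseteq> bought A \<omega> (xs @ ys)" by (auto simp: arrivals_def)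
  with bought_snoc[of \<omega> "xs @ ys" y] snoc.prems show ?case by auto
qed simp

lemma expected_cost_append:
  assumes "xs @ ys \<in> arrivals P"
  shows "expected_cost P A xs \<le> expected_cost P A (xs @ ys)"
  unfolding expected_cost_def
proof (rule integral_mono)
  show "integrable (seed A) (\<lambda>\<omega>. cost P (bought A \<omega> xs))"
    by (rule integrable_cost) (use assms in \<open>auto simp: arrivals_def\<close>)
  show "cost P (bought A \<omega> xs) \<le> cost P (bought A \<omega> (xs @ ys))" if "\<omega> \<in> space (seed A)" for \<omega>
    by (rule cost_mono[OF bought_append bought_solution]) (use that assms in auto)
qed (use assms in \<open>simp add: integrable_cost\<close>)

lemma arrivals_ex:
  assumes "finite X" "X \<subseteq> requests P"
  obtains xs where "xs \<in> arrivals P" "set xs = X"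
  using finite_distinct_list[OF assms(1)] assms(2) by (auto simp: arrivals_def)

lemma solutions_nonempty:
  assumes "finite X" "X \<subseteq> requests P"
  shows "solutions P X \<noteq> {}"
  using arrivals_ex[OF assms] bought_solution not_empty by (metis all_not_in_conv)

lemma opt_nonneg:
  assumes "finite X" "X \<subseteq> requests P"
  shows "0 \<le> opt P X"
  unfolding opt_def
  by (rule cInf_greatest) (use solutions_nonempty[OF assms] in \<open>auto intro: cost_nonneg\<close>)

text \<open>Otherwise every outcome of the given algorithm on \<open>X\<close> would have positive
  cost, and so would the expectation, against the bound \<open>\<rho> (card X) * 0\<close>.\<close>

lemma zero_cost_solution:
  assumes "finite X" "X \<subseteq> requests P" "opt P X = 0"
  shows "\<exists>S\<in>solutions P X. cost P S = 0"
proof (rule ccontr)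
  assume neg: "\<not> ?thesis"
  obtain xs where xs: "xs \<in> arrivals P" "set xs = X" using arrivals_ex assms by blast
  have pos: "0 < cost P (bought A \<omega> xs)" if "\<omega> \<in> space (seed A)" for \<omega>
    using neg bought_solution[OF that xs(1)] cost_nonneg xs(2) by force
  have "0 < expected_cost P A xs"
    using integral_less_AE_space[of "\<lambda>_. 0" "\<lambda>\<omega>. cost P (bought A \<omega> xs)"] xs pos
    by (simp add: expected_cost_def integrable_cost emeasure_space_1)
  with expected_cost_le[OF xs(1)] assms xs show False by simp
qed

text \<open>A positive optimum lies strictly below its double, so some solution fits in between. For
  optimum 0 the factor 2 gives no slack, and the infimum has to be attained.\<close>

lemma near_opt:
  assumes "finite X" "X \<subseteq> requests P"
  shows "near_opt P X \<in> solutions P X" "cost P (near_opt P X) \<le> 2 * opt P X"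
proof -
  have "\<exists>S. S \<in> solutions P X \<and> cost P S \<le> 2 * opt P X"
  proof (cases "opt P X = 0")
    case True
    then show ?thesis using zero_cost_solution[OF assms] by auto
  next
    case False
    then have "opt P X < 2 * opt P X" using opt_nonneg[OF assms] by simp
    then have "Inf (cost P ` solutions P X) < 2 * opt P X" by (simp add: opt_def)
    then obtain y where "y \<in> cost P ` solutions P X" "y < 2 * opt P X"
      using cInf_lessD[of "cost P ` solutions P X"] solutions_nonempty[OF assms] by auto
    then show ?thesis by (auto intro: less_imp_le)
  qed
  then have "near_opt P X \<in> solutions P X \<and> cost P (near_opt P X) \<le> 2 * opt P X"
    unfolding near_opt_def by (rule someI_ex)
  then show "near_opt P X \<in> solutions P X" "cost P (near_opt P X) \<le> 2 * opt P X" by auto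
qed

text \<open>
  If all subsets of size \<open>n > 0\<close> have optimum 0, then so do all singletons and hence \<open>X\<close>;
  otherwise \<open>opt \<le> expected_cost \<le> \<rho> n * opt\<close> for a subset with positive optimum.
\<close>

lemma ratio_ge_1:
  assumes "finite X" "X \<subseteq> requests P" "n \<le> card X" "opt P X \<noteq> 0"
  shows "1 \<le> \<rho> n"
proof (cases "n = 0")
  case False
  have "\<exists>W\<subseteq>X. card W = n \<and> opt P W \<noteq> 0"
  proof (rule ccontr)
    assume neg: "\<not> ?thesis"
    have zero: "\<exists>S\<in>solutions P V. cost P S = 0" if "V \<subseteq> X" "card V \<le> n" for V
    proof -
      have "\<exists>W. V \<subseteq> W \<and> W \<subseteq> X \<and> card W = n"
        using exists_subset_between[of V n X] that assms by blast
      then obtain W where W: "V \<subseteq> W" "W \<subseteq> X" "card W = n" by blast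
      then have fin: "finite W" "W \<subseteq> requests P" using assms finite_subset by auto
      then obtain S where "S \<in> solutions P W" "cost P S = 0"
        using neg zero_cost_solution[of W] W by blast
      then show ?thesis using solutions_antimono[OF _ W(1) fin] by blast
    qed
    have "\<exists>S\<in>solutions P X. cost P S = 0"
      by (rule zero_cost_solution_if_singletons) (use assms False in \<open>auto intro!: zero\<close>)
    then show False using opt_le opt_nonneg[of X] assms by force
  qed
  then obtain W where W: "W \<subseteq> X" "card W = n" "opt P W \<noteq> 0" by blast
  then have fin: "finite W" "W \<subseteq> requests P" using assms finite_subset by auto
  obtain ws where ws: "ws \<in> arrivals P" "set ws = W" using arrivals_ex fin by blast
  have "1 * opt P W \<le> \<rho> n * opt P W"
    using expected_cost_ge[OF ws(1)] expected_cost_le[OF ws(1)] ws W by simp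
  then show ?thesis using opt_nonneg[OF fin] W by simp
\<comment> \<open>If \<open>opt P {} = 0\<close>, competitiveness does not constrain
  \<open>\<rho> 0\<close>; the case of error 0 therefore rests on \<open>ratio_0\<close>.\<close>
qed (use ratio_0 in simp)

text \<open>For optimum 0, \<open>ratio_ge_1\<close> gives nothing and \<open>\<rho> n\<close> may
  even be negative, so the bound is stated after multiplication by the optimum.\<close>

lemma opt_le_ratio:
  assumes "finite X" "X \<subseteq> requests P" "n \<le> card X"
  shows "opt P X \<le> \<rho> n * opt P X"
proof (cases "opt P X = 0")
  case False
  then have "1 * opt P X \<le> \<rho> n * opt P X"
    by (intro mult_right_mono ratio_ge_1) (use assms opt_nonneg in auto)
  then show ?thesis by simp
qed simp

text \<open>
  The run on \<open>zs\<close> is a prefix of a run on exactly \<open>n\<close> requests from \<open>X\<close>; this replaces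
  monotonicity of \<open>\<rho>\<close>.
\<close>

lemma expected_cost_le_of_subset:
  assumes "finite X" "X \<subseteq> requests P" "distinct zs" "set zs \<subseteq> X" "length zs \<le> n" "n \<le> card X"
  shows "expected_cost P A zs \<le> \<rho> n * opt P X"
proof -
  obtain W where W: "set zs \<subseteq> W" "W \<subseteq> X" "card W = n"
    using exists_subset_between[of "set zs" n X] assms by (auto simp: distinct_card)
  then have fin: "finite W" "W \<subseteq> requests P" using assms finite_subset by auto
  obtain ws where ws: "distinct ws" "set ws = W - set zs"
    using finite_distinct_list fin by blast
  have arr: "zs @ ws \<in> arrivals P" and set: "set (zs @ ws) = W"
    using assms W ws fin by (auto simp: arrivals_def)
  have "expected_cost P A zs \<le> \<rho> n * opt P W"
    using expected_cost_append[OF arr] expected_cost_le[OF arr] set W by simp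
  also have "\<dots> \<le> \<rho> n * opt P X"
  proof -
    have le: "opt P W \<le> opt P X"
      by (rule opt_mono[OF W(2) assms(1,2) solutions_nonempty[OF assms(1,2)]])
    show ?thesis
    \<comment> \<open>Multiplying \<open>le\<close> by \<open>\<rho> n\<close> requires its sign,
      known only for positive optimum; otherwise both sides vanish.\<close>
    proof (cases "opt P X = 0")
      case True
      then have "opt P W = 0" using le opt_nonneg[OF fin] by simp
      with True show ?thesis by simp
    next
      case False
      then have "1 \<le> \<rho> n" by (intro ratio_ge_1[OF assms(1,2,6)])
      then show ?thesis using le by (intro mult_left_mono) auto
    qed
  qed
  finally show ?thesis .
qed

end

section \<open>The invariant of the phases\<close>

locale predicted_instance = competitive_instance +
  fixes Xhat
  assumes finite_prediction: "finite Xhat" and prediction_requests: "Xhat \<subseteq> requests P"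
begin

text \<open>The premise makes \<open>({}, near_opt P {})\<close> affordable, and cardinalities are
  bounded by \<open>card Xhat\<close>, so a maximum exists.\<close>

lemma partial_cover:
  assumes "2 * opt P {} \<le> B"
  shows "affordable P Xhat B (partial_cover P Xhat B)"
    and "affordable P Xhat B TH' \<Longrightarrow> card (fst TH') \<le> card (fst (partial_cover P Xhat B))"
proof -
  have ex: "affordable P Xhat B ({}, near_opt P {})"
    using near_opt[of "{}"] assms by (auto simp: affordable_def)
  have "\<forall>TH. affordable P Xhat B TH \<longrightarrow> card (fst TH) < Suc (card Xhat)"
    using card_mono finite_prediction by (fastforce simp: affordable_def less_Suc_eq_le)
  from ex_has_greatest_nat[OF ex this]
  have "\<exists>TH. affordable P Xhat B TH \<and>
      (\<forall>TH'. affordable P Xhat B TH' \<longrightarrow> card (fst TH') \<le> card (fst TH))" by blast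
  then have "affordable P Xhat B (partial_cover P Xhat B) \<and>
      (\<forall>TH'. affordable P Xhat B TH' \<longrightarrow> card (fst TH') \<le> card (fst (partial_cover P Xhat B)))"
    unfolding partial_cover_def by (rule someI_ex)
  then show "affordable P Xhat B (partial_cover P Xhat B)"
    and "affordable P Xhat B TH' \<Longrightarrow> card (fst TH') \<le> card (fst (partial_cover P Xhat B))"
    by blast+
qed

text \<open>\<open>D\<close> is what the offline purchases serve without the runs. The last clause
  ranges over all request sets that may still arise, because \<open>prediction_error\<close> can
  decrease as requests arrive and \<open>\<rho>\<close> need not be monotone.\<close>

definition invariant :: "'a list \<Rightarrow> ('a, 'b) state \<Rightarrow> bool" where
  "invariant xs st \<longleftrightarrow>
     covered st \<subseteq> Xhat \<and>
     (\<forall>TH. affordable P Xhat (budget st) TH \<longrightarrow> card (fst TH) \<le> card (covered st)) \<and>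
     distinct (current st) \<and> set (current st) \<subseteq> set xs - covered st \<and>
     set (past st) \<subseteq> arrivals P \<and>
     (\<exists>D. finite D \<and> D \<subseteq> requests P \<and> covered st \<subseteq> D \<and> set xs \<subseteq> D \<union> set (current st) \<and>
        offline st \<in> solutions P D) \<and>
     expected_cost P A (current st) \<le> budget st \<and>
     cost P (offline st) + (\<Sum>zs\<leftarrow>past st. expected_cost P A zs) \<le> 5 * budget st \<and>
     (\<forall>X. finite X \<and> X \<subseteq> requests P \<and> set xs \<subseteq> X \<longrightarrow>
        budget st \<le> 4 * (\<rho> (prediction_error X Xhat) * opt P X))"

lemma current_arrivals:
  "invariant xs st \<Longrightarrow> xs \<in> arrivals P \<Longrightarrow> current st \<in> arrivals P"
  by (auto simp: invariant_def arrivals_def)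

lemma runs_arrivals:
  "invariant xs st \<Longrightarrow> xs \<in> arrivals P \<Longrightarrow> set (current st # past st) \<subseteq> arrivals P"
  using current_arrivals by (simp add: invariant_def)

lemma expected_cost_nonneg: "xs \<in> arrivals P \<Longrightarrow> 0 \<le> expected_cost P A xs"
  using expected_cost_ge[of xs] opt_nonneg[of "set xs"] by (auto simp: arrivals_def)

lemma Nil_arrivals [simp]: "[] \<in> arrivals P"
  by (simp add: arrivals_def)

lemma invariant_initial: "invariant [] (initial P A Xhat)"
proof -
  let ?B = "2 * expected_cost P A []" and ?TH = "partial_cover P Xhat (2 * expected_cost P A [])"
  have B: "2 * opt P {} \<le> ?B" using expected_cost_ge[of "[]"] by simp
  note pc = partial_cover[OF B]
  have nn: "0 \<le> expected_cost P A []" by (rule expected_cost_nonneg) simp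
  have "?B \<le> 4 * (\<rho> (prediction_error X Xhat) * opt P X)" if "finite X" "X \<subseteq> requests P" for X
  proof -
    \<comment> \<open>The empty run is a prefix of a run on exactly
      \<open>prediction_error X Xhat\<close> requests of \<open>X\<close>.\<close>
    have "expected_cost P A [] \<le> \<rho> (prediction_error X Xhat) * opt P X"
      by (rule expected_cost_le_of_subset) (use that in \<open>auto simp: prediction_error_le_card\<close>)
    then show ?thesis using nn by linarith
  qed
  moreover have "\<exists>D. finite D \<and> D \<subseteq> requests P \<and> fst ?TH \<subseteq> D \<and> snd ?TH \<in> solutions P D"
    using pc(1) finite_prediction prediction_requests
    by (intro exI[of _ "fst ?TH"]) (auto simp: affordable_def intro: finite_subset)
  ultimately show ?thesis
    using pc nn by (auto simp: invariant_def initial_def Let_def affordable_def)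
qed

text \<open>\<open>near_opt P X\<close> fits into the budget and serves
  \<open>X \<inter> Xhat\<close>, so by maximality \<open>covered st\<close> is at least as large,
  though possibly a different set. Hence at most \<open>card (Xhat - X)\<close> predicted requests
  stay uncovered.\<close>

lemma length_uncovered_le:
  assumes X: "finite X" "X \<subseteq> requests P" and B: "2 * opt P X \<le> budget st"
    and inv: "invariant xs st"
    and zs: "distinct zs" "set zs \<subseteq> X - covered st"
  shows "length zs \<le> prediction_error X Xhat"
proof -
  let ?T = "covered st"
  have T: "?T \<subseteq> Xhat" "finite ?T"
    using inv finite_prediction finite_subset by (auto simp: invariant_def)
  have "near_opt P X \<in> solutions P (X \<inter> Xhat)"
    by (rule solutions_antimono[OF near_opt(1)[OF X] Int_lower1 X])
  then have "affordable P Xhat (budget st) (X \<inter> Xhat, near_opt P X)"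
    using near_opt(2)[OF X] B by (auto simp: affordable_def)
  then have "card (X \<inter> Xhat) \<le> card ?T" using inv unfolding invariant_def by fastforce
  moreover have "card (Xhat - ?T) = card Xhat - card ?T"
    using T by (simp add: card_Diff_subset)
  moreover have "card (Xhat - X) = card Xhat - card (X \<inter> Xhat)"
    using finite_prediction by (metis Diff_Int2 Diff_Int_distrib2 card_Diff_subset_Int
        inf_commute finite_Int)
  ultimately have uncovered: "card (Xhat - ?T) \<le> card (Xhat - X)" by simp
  have "length zs = card (set zs)" using zs by (simp add: distinct_card)
  moreover have "card (set zs) \<le> card X" using zs X by (intro card_mono) auto
  \<comment> \<open>An uncovered request is either unpredicted or among the predicted ones left out.
    The preceding bound handles the other argument of \<open>min\<close>.\<close>
  moreover have "card (set zs) \<le> card ((X - Xhat) \<union> (Xhat - ?T))"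
    using zs X finite_prediction by (intro card_mono) auto
  moreover have "card ((X - Xhat) \<union> (Xhat - ?T)) \<le> card (X - Xhat) + card (Xhat - ?T)"
    by (rule card_Un_le)
  moreover have "card ((X - Xhat) \<union> (Xhat - X)) = card (X - Xhat) + card (Xhat - X)"
    using X finite_prediction by (intro card_Un_disjoint) auto
  ultimately show ?thesis using uncovered by (simp add: prediction_error_def)
qed

lemma invariant_new_phase:
  assumes inv: "invariant xs st" and arr: "xs @ [x] \<in> arrivals P"
    and x: "x \<notin> covered st" and exceeds: "budget st < expected_cost P A (current st @ [x])"
  shows "invariant (xs @ [x]) (new_phase P Xhat (set (xs @ [x])) st)"
proof -
  let ?Y = "set (xs @ [x])"
  define B where "B = 2 * max (budget st) (opt P ?Y)"
  define T where "T = fst (partial_cover P Xhat B)"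
  define H where "H = snd (partial_cover P Xhat B)"
  let ?N = "near_opt P ?Y"
  have st': "new_phase P Xhat ?Y st = \<lparr>budget = B, covered = T,
      offline = offline st \<union> ?N \<union> H, past = current st # past st, current = []\<rparr>"
    by (simp add: new_phase_def Let_def B_def T_def H_def)
  have Y: "finite ?Y" "?Y \<subseteq> requests P" using arr by (auto simp: arrivals_def)
  have xs: "xs \<in> arrivals P" using arr by (auto simp: arrivals_def)
  have cur: "current st \<in> arrivals P" by (rule current_arrivals[OF inv xs])
  have "opt P {} \<le> opt P ?Y" by (rule opt_mono) (use Y solutions_nonempty in auto)
  moreover have "0 \<le> opt P {}" by (rule opt_nonneg) auto
  ultimately have "2 * opt P {} \<le> B" by (simp add: B_def)
  note pc = partial_cover[OF this]
  have T: "T \<subseteq> Xhat" "H \<in> solutions P T" "cost P H \<le> B"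
    using pc(1) by (auto simp: affordable_def T_def H_def)
  have fT: "finite T" "T \<subseteq> requests P"
    using T finite_prediction prediction_requests finite_subset by auto
  obtain D where D: "finite D" "D \<subseteq> requests P" "offline st \<in> solutions P D"
    using inv unfolding invariant_def by (elim conjE exE)
  have off1: "offline st \<union> ?N \<in> solutions P (D \<union> ?Y)"
    by (rule solutions_Un) (use D Y near_opt in auto)
  have off2: "offline st \<union> ?N \<union> H \<in> solutions P (D \<union> ?Y \<union> T)"
    by (rule solutions_Un[OF off1 T(2)]) (use D Y fT in auto)
  have nn: "0 \<le> expected_cost P A (current st)" by (rule expected_cost_nonneg[OF cur])
  have le: "expected_cost P A (current st) \<le> budget st"
    using inv by (simp add: invariant_def)
  have B2: "2 * budget st \<le> B" "2 * opt P ?Y \<le> B" by (auto simp: B_def)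
  \<comment> \<open>The new run starts empty but may already cost something; as a prefix of the old
    run it stays within the old budget.\<close>
  have empty: "expected_cost P A [] \<le> B"
    using expected_cost_append[of "[]" "current st"] cur le nn B2 by simp
  have "cost P (offline st \<union> ?N \<union> H) \<le> cost P (offline st) + cost P ?N + cost P H"
    using cost_Un_le[OF off1 T(2)] cost_Un_le[OF D(3) near_opt(1)[OF Y]] by simp
  then have "cost P (offline st \<union> ?N \<union> H) \<le> cost P (offline st) + B + B"
    using near_opt(2)[OF Y] B2 T(3) by simp
  moreover have "cost P (offline st) + (\<Sum>zs\<leftarrow>past st. expected_cost P A zs) \<le> 5 * budget st"
    using inv by (simp add: invariant_def)
  \<comment> \<open>The old total and the closed run amount to at most
    \<open>6 * budget st \<le> 3 * B\<close>; the near-optimal solution and the partial cover add at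
    most \<open>2 * B\<close>.\<close>
  ultimately have total: "cost P (offline st \<union> ?N \<union> H) +
      (\<Sum>zs\<leftarrow>current st # past st. expected_cost P A zs) \<le> 5 * B"
    using le B2 by simp
  have bound: "B \<le> 4 * (\<rho> (prediction_error X Xhat) * opt P X)"
    if X: "finite X" "X \<subseteq> requests P" "?Y \<subseteq> X" for X
  proof -
    let ?\<eta> = "prediction_error X Xhat"
    note \<eta> = prediction_error_le_card[of X Xhat]
    have ratio: "opt P X \<le> \<rho> ?\<eta> * opt P X" by (rule opt_le_ratio) (use X \<eta> in auto)
    have nnX: "0 \<le> opt P X" by (rule opt_nonneg[OF X(1,2)])
    have Y_le: "opt P ?Y \<le> opt P X" by (rule opt_mono[OF X(3,1,2) solutions_nonempty[OF X(1,2)]])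
    \<comment> \<open>The counting bound requires a budget of at least \<open>2 * opt P X\<close>; a
      smaller budget is small enough by itself.\<close>
    have "budget st \<le> 2 * (\<rho> ?\<eta> * opt P X)"
    proof (cases "2 * opt P X \<le> budget st")
      case True
      have zs: "distinct (current st @ [x])" "set (current st @ [x]) \<subseteq> X - covered st"
        using inv arr x X by (auto simp: invariant_def arrivals_def)
      \<comment> \<open>The run is counted with \<open>x\<close>, which was never passed to it,
        since it is this longer run whose expected cost exceeds the budget.\<close>
      have "length (current st @ [x]) \<le> ?\<eta>"
        by (rule length_uncovered_le[OF X(1,2) True inv zs])
      then have "expected_cost P A (current st @ [x]) \<le> \<rho> ?\<eta> * opt P X"
        by (intro expected_cost_le_of_subset) (use X zs \<eta> in auto)
      then show ?thesis using exceeds ratio nnX by simp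
    next
      case False
      then show ?thesis using ratio by simp
    qed
    \<comment> \<open>Both arguments of the maximum in \<open>B\<close> now have the same bound with
      factor 2, so the doubling yields 4.\<close>
    moreover have "opt P ?Y \<le> 2 * (\<rho> ?\<eta> * opt P X)" using Y_le ratio nnX by linarith
    ultimately show ?thesis unfolding B_def by linarith
  qed
  have past: "set (current st # past st) \<subseteq> arrivals P" by (rule runs_arrivals[OF inv xs])
  show ?thesis
    unfolding invariant_def st' state.simps
  proof (intro conjI)
    show "\<exists>D. finite D \<and> D \<subseteq> requests P \<and> T \<subseteq> D \<and> ?Y \<subseteq> D \<union> set [] \<and>
        offline st \<union> ?N \<union> H \<in> solutions P D"
      using off2 D Y fT by (intro exI[of _ "D \<union> ?Y \<union> T"]) auto
  qed (use T(1) pc(2) past empty total bound in \<open>auto simp: T_def\<close>)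
qed

lemma invariant_state:
  "xs \<in> arrivals P \<Longrightarrow> invariant xs (state_after P A Xhat (rev xs))"
proof (induction xs rule: rev_induct)
  case Nil
  then show ?case by (simp add: invariant_initial)
next
  case (snoc x xs)
  let ?st = "state_after P A Xhat (rev xs)"
  have inv: "invariant xs ?st" using snoc by (auto simp: arrivals_def)
  have x: "x \<notin> set xs" using snoc.prems by (auto simp: arrivals_def)
  consider "x \<in> covered ?st" |
    "x \<notin> covered ?st" "expected_cost P A (current ?st @ [x]) \<le> budget ?st" |
    "x \<notin> covered ?st" "budget ?st < expected_cost P A (current ?st @ [x])" by fastforce
  then show ?case
  proof cases
    case 1
    have covers: "set (xs @ [x]) \<subseteq> D \<union> C" if "covered ?st \<subseteq> D" "set xs \<subseteq> D \<union> C" for C D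
      using that 1 by auto
    have "invariant (xs @ [x]) ?st"
      unfolding invariant_def
    proof (intro conjI)
      show "\<exists>D. finite D \<and> D \<subseteq> requests P \<and> covered ?st \<subseteq> D \<and>
          set (xs @ [x]) \<subseteq> D \<union> set (current ?st) \<and> offline ?st \<in> solutions P D"
        using inv covers unfolding invariant_def by meson
    qed (use inv in \<open>simp_all add: invariant_def subset_iff\<close>)
    then show ?thesis using 1 by (simp add: Let_def)
  next
    case 2
    have covers: "set (xs @ [x]) \<subseteq> D \<union> set (current ?st @ [x])"
      if "set xs \<subseteq> D \<union> set (current ?st)" for D
      using that by auto
    let ?st' = "?st\<lparr>current := current ?st @ [x]\<rparr>"
    have D: "\<exists>D. finite D \<and> D \<subseteq> requests P \<and> covered ?st \<subseteq> D \<and>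
        set (xs @ [x]) \<subseteq> D \<union> set (current ?st @ [x]) \<and> offline ?st \<in> solutions P D"
      using inv covers unfolding invariant_def by meson
    have "invariant (xs @ [x]) ?st'"
      unfolding invariant_def
    proof (intro conjI)
      show "\<exists>D. finite D \<and> D \<subseteq> requests P \<and> covered ?st' \<subseteq> D \<and>
          set (xs @ [x]) \<subseteq> D \<union> set (current ?st') \<and> offline ?st' \<in> solutions P D"
        using D by simp
    qed (use inv 2 x in \<open>auto simp: invariant_def\<close>)
    then show ?thesis using 2 by (simp add: Let_def)
  next
    case 3
    then show ?thesis
      using invariant_new_phase[OF inv snoc.prems 3] by (simp add: Let_def)
  qed
qed

section \<open>Feasibility, cost and measurability of the purchases\<close>

lemma purchases_mono:
  assumes \<omega>: "\<omega> \<in> space (seed A)" and arr: "xs @ [x] \<in> arrivals P"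
  shows "purchases A \<omega> (state_after P A Xhat (rev xs))
    \<subseteq> purchases A \<omega> (state_after P A Xhat (rev (xs @ [x])))"
proof -
  let ?st = "state_after P A Xhat (rev xs)"
  have inv: "invariant xs ?st" using arr invariant_state by (auto simp: arrivals_def)
  then have "current ?st @ [x] \<in> arrivals P"
    using arr by (auto simp: invariant_def arrivals_def)
  then have "bought A \<omega> (current ?st) \<subseteq> bought A \<omega> (current ?st @ [x])"
    using bought_snoc \<omega> by blast
  \<comment> \<open>A new phase only adds to \<open>offline\<close> and moves the current run to
    \<open>past\<close>; the other possible change is the extension of the current run.\<close>
  then show ?thesis by (auto simp: purchases_def Let_def new_phase_def)
qed

lemma runs_solution:
  assumes "\<omega> \<in> space (seed A)" "S \<in> solutions P D" "finite D" "D \<subseteq> requests P"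
    and "set zss \<subseteq> arrivals P"
  shows "S \<union> (\<Union>zs\<in>set zss. bought A \<omega> zs) \<in> solutions P (D \<union> (\<Union>zs\<in>set zss. set zs))"
    and "cost P (S \<union> (\<Union>zs\<in>set zss. bought A \<omega> zs))
      \<le> cost P S + (\<Sum>zs\<leftarrow>zss. cost P (bought A \<omega> zs))"
  using assms(5)
proof (induction zss)
  case Nil
  {
    case 1
    show ?case using assms by simp
  next
    case 2
    show ?case by simp
  }
next
  case (Cons zs zss)
  let ?U = "S \<union> (\<Union>zs\<in>set zss. bought A \<omega> zs)" and ?D = "D \<union> (\<Union>zs\<in>set zss. set zs)"
  have eq: "S \<union> (\<Union>zs\<in>set (zs # zss). bought A \<omega> zs) = bought A \<omega> zs \<union> ?U"
    "D \<union> (\<Union>zs\<in>set (zs # zss). set zs) = set zs \<union> ?D" by auto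
  {
    case 1
    have "bought A \<omega> zs \<union> ?U \<in> solutions P (set zs \<union> ?D)"
      by (rule solutions_Un)
        (use 1 Cons assms in \<open>auto simp: bought_solution arrivals_def\<close>)
    then show ?case unfolding eq .
  next
    case 2
    have "cost P (bought A \<omega> zs \<union> ?U) \<le> cost P (bought A \<omega> zs) + cost P ?U"
      by (rule cost_Un_le[OF bought_solution Cons.IH(1)]) (use 2 assms in auto)
    then show ?case unfolding eq using Cons.IH(2) 2 by simp
  }
qed

lemma purchases_solution:
  assumes \<omega>: "\<omega> \<in> space (seed A)" and xs: "xs \<in> arrivals P" and inv: "invariant xs st"
  shows "purchases A \<omega> st \<in> solutions P (set xs)"
    and "cost P (purchases A \<omega> st)
      \<le> cost P (offline st) + (\<Sum>zs\<leftarrow>current st # past st. cost P (bought A \<omega> zs))"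
proof -
  obtain D where D: "finite D" "D \<subseteq> requests P" "set xs \<subseteq> D \<union> set (current st)"
      "offline st \<in> solutions P D"
    using inv unfolding invariant_def by (elim conjE exE)
  have zss: "set (current st # past st) \<subseteq> arrivals P" by (rule runs_arrivals[OF inv xs])
  note runs = runs_solution[OF \<omega> D(4,1,2) zss]
  \<comment> \<open>The purchases may serve more than has arrived, such as predicted requests; a
    solution for the larger set also serves \<open>set xs\<close>.\<close>
  show "purchases A \<omega> st \<in> solutions P (set xs)"
    unfolding purchases_def
    by (rule solutions_antimono[OF runs(1)]) (use D zss in \<open>auto simp: arrivals_def\<close>)
  show "cost P (purchases A \<omega> st)
      \<le> cost P (offline st) + (\<Sum>zs\<leftarrow>current st # past st. cost P (bought A \<omega> zs))"
    unfolding purchases_def by (rule runs(2))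
qed

text \<open>Measurability of a union into \<open>count_space UNIV\<close> is obtained from the
  countable range of one operand, so measurability and countability are proved together.\<close>

lemma runs_discrete:
  assumes "set zss \<subseteq> arrivals P"
  shows "(\<lambda>\<omega>. S \<union> (\<Union>zs\<in>set zss. bought A \<omega> zs)) \<in> measurable (seed A) (count_space UNIV)"
    and "countable ((\<lambda>\<omega>. S \<union> (\<Union>zs\<in>set zss. bought A \<omega> zs)) ` space (seed A))"
  using assms
proof (induction zss)
  case Nil
  {
    case 1
    show ?case by simp
  next
    case 2
    show ?case by (auto intro: countable_subset[of _ "{S}"])
  }
next
  case (Cons zs zss)
  let ?f = "\<lambda>\<omega>. bought A \<omega> zs" and ?g = "\<lambda>\<omega>. S \<union> (\<Union>zs\<in>set zss. bought A \<omega> zs)"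
  have eq: "(\<lambda>\<omega>. S \<union> (\<Union>zs\<in>set (zs # zss). bought A \<omega> zs)) = (\<lambda>\<omega>. ?f \<omega> \<union> ?g \<omega>)"
    by auto
  {
    case 1
    note f = bought_measurable[of zs] bought_countable[of zs] and g = Cons.IH
    \<comment> \<open>Split by the countably many values \<open>F\<close> of \<open>?f\<close>; for
      fixed \<open>F\<close> the union depends on \<open>?g\<close> alone.\<close>
    have "(\<lambda>\<omega>. ?f \<omega> \<union> ?g \<omega>) \<in> measurable (seed A) (count_space UNIV)"
    proof (rule measurable_compose_countable'[where I = "?f ` space (seed A)"
          and g = ?f and f = "\<lambda>F \<omega>. F \<union> ?g \<omega>"])
      show "?f \<in> measurable (seed A) (count_space (?f ` space (seed A)))"
        using measurable_restrict_space2[of ?f "seed A" "?f ` space (seed A)" "count_space UNIV"] f(1) 1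
        by (auto simp: restrict_count_space)
      show "(\<lambda>\<omega>. F \<union> ?g \<omega>) \<in> measurable (seed A) (count_space UNIV)" for F
        by (rule measurable_compose[OF g(1)]) (use 1 in auto)
      show "countable (?f ` space (seed A))" using f(2) 1 by simp
    qed
    then show ?case unfolding eq .
  next
    case 2
    have "countable (?f ` space (seed A))" "countable (?g ` space (seed A))"
      using bought_countable[of zs] Cons.IH(2) 2 by auto
    then have "countable ((\<lambda>(F, G). F \<union> G) ` (?f ` space (seed A) \<times> ?g ` space (seed A)))"
      by (rule countable_image[OF countable_SIGMA])
    then show ?case unfolding eq by (rule countable_subset[rotated]) auto
  }
qed

section \<open>Guarantees of the algorithm with prediction\<close>

lemma online_with_prediction: "online_algorithm P (with_prediction P A Xhat)"
proof -
  let ?st = "\<lambda>xs. state_after P A Xhat (rev xs)"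
  have "(\<lambda>\<omega>. purchases A \<omega> (?st xs)) \<in> measurable (seed A) (count_space UNIV)"
    "countable ((\<lambda>\<omega>. purchases A \<omega> (?st xs)) ` space (seed A))" if "xs \<in> arrivals P" for xs
    unfolding purchases_def
    using runs_discrete[OF runs_arrivals[OF invariant_state[OF that] that]] by auto
  moreover have "purchases A \<omega> (?st xs) \<in> solutions P (set xs)"
    if "\<omega> \<in> space (seed A)" "xs \<in> arrivals P" for \<omega> xs
    by (rule purchases_solution(1)[OF that invariant_state[OF that(2)]])
  ultimately show ?thesis
    using purchases_mono prob_space_axioms
    unfolding online_algorithm_def with_prediction_def algorithm.simps by blast
qed

lemma competitive_with_prediction:
  "competitive P (with_prediction P A Xhat) (\<lambda>X. 24 * \<rho> (prediction_error X Xhat))"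
proof -
  have "integrable (seed A) (\<lambda>\<omega>. cost P (purchases A \<omega> (state_after P A Xhat (rev xs)))) \<and>
    expectation (\<lambda>\<omega>. cost P (purchases A \<omega> (state_after P A Xhat (rev xs))))
      \<le> 24 * \<rho> (prediction_error (set xs) Xhat) * opt P (set xs)" if xs: "xs \<in> arrivals P" for xs
  proof -
    define st where "st = state_after P A Xhat (rev xs)"
    have inv: "invariant xs st" unfolding st_def by (rule invariant_state[OF xs])
    have zss: "set (current st # past st) \<subseteq> arrivals P" by (rule runs_arrivals[OF inv xs])
    \<comment> \<open>An upper bound that counts a resource once per run buying it. All runs share
      the seed, but linearity of expectation does not require independence.\<close>
    define h where "h \<omega> = cost P (offline st) +
      (\<Sum>zs\<leftarrow>current st # past st. cost P (bought A \<omega> zs))" for \<omega>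
    have sum: "integrable (seed A) (\<lambda>\<omega>. \<Sum>zs\<leftarrow>zss. cost P (bought A \<omega> zs)) \<and>
        expectation (\<lambda>\<omega>. \<Sum>zs\<leftarrow>zss. cost P (bought A \<omega> zs)) = (\<Sum>zs\<leftarrow>zss. expected_cost P A zs)"
      if "set zss \<subseteq> arrivals P" for zss
      using that by (induction zss) (auto simp: integrable_cost expected_cost_def)
    have int_h: "integrable (seed A) h"
      unfolding h_def using sum[OF zss] by (intro Bochner_Integration.integrable_add) auto
    have exp_h: "expectation h =
        cost P (offline st) + (\<Sum>zs\<leftarrow>current st # past st. expected_cost P A zs)"
      unfolding h_def using sum[OF zss]
      by (subst Bochner_Integration.integral_add) (auto simp: prob_space)
    have meas: "(\<lambda>\<omega>. cost P (purchases A \<omega> st)) \<in> borel_measurable (seed A)"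
      unfolding purchases_def by (rule measurable_compose[OF runs_discrete(1)[OF zss]]) simp
    have le_h: "cost P (purchases A \<omega> st) \<le> h \<omega>" "0 \<le> cost P (purchases A \<omega> st)"
      if "\<omega> \<in> space (seed A)" for \<omega>
      unfolding h_def using purchases_solution[OF that xs inv] cost_nonneg by auto
    have int: "integrable (seed A) (\<lambda>\<omega>. cost P (purchases A \<omega> st))"
      by (rule Bochner_Integration.integrable_bound[OF int_h meas])
        (use le_h in \<open>force intro!: AE_I2\<close>)
    have "expectation (\<lambda>\<omega>. cost P (purchases A \<omega> st)) \<le> expectation h"
      by (rule integral_mono[OF int int_h]) (use le_h in auto)
    \<comment> \<open>Five budgets pay for offline purchases and past runs, one for the current
      run.\<close>
    also have "\<dots> \<le> 6 * budget st"
      using inv unfolding exp_h by (simp add: invariant_def)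
    also have "\<dots> \<le> 6 * (4 * (\<rho> (prediction_error (set xs) Xhat) * opt P (set xs)))"
    proof (rule mult_left_mono)
      have "\<forall>X. finite X \<and> X \<subseteq> requests P \<and> set xs \<subseteq> X \<longrightarrow>
          budget st \<le> 4 * (\<rho> (prediction_error X Xhat) * opt P X)"
        using inv unfolding invariant_def by (elim conjE)
      from this[rule_format, of "set xs"] xs
      show "budget st \<le> 4 * (\<rho> (prediction_error (set xs) Xhat) * opt P (set xs))"
        by (simp add: arrivals_def)
    qed simp
    finally show ?thesis using int unfolding st_def by simp
  qed
  then show ?thesis by (simp add: competitive_def with_prediction_def)
qed

lemma deterministic_with_prediction:
  assumes "deterministic P A"
  shows "deterministic P (with_prediction P A Xhat)"
proof -
  have "purchases A \<omega> (state_after P A Xhat (rev xs)) = purchases A \<omega>' (state_after P A Xhat (rev xs))"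
    if "\<omega> \<in> space (seed A)" "\<omega>' \<in> space (seed A)" "xs \<in> arrivals P" for \<omega> \<omega>' xs
  proof -
    let ?st = "state_after P A Xhat (rev xs)"
    have inv: "invariant xs ?st" by (rule invariant_state[OF that(3)])
    have "set (current ?st # past ?st) \<subseteq> arrivals P" by (rule runs_arrivals[OF inv that(3)])
    then have "bought A \<omega> zs = bought A \<omega>' zs" if "zs \<in> set (current ?st # past ?st)" for zs
      using assms that \<open>\<omega> \<in> _\<close> \<open>\<omega>' \<in> _\<close> unfolding deterministic_def by blast
    then show ?thesis unfolding purchases_def by (metis (no_types, lifting) SUP_cong)
  qed
  then show ?thesis unfolding deterministic_def with_prediction_def algorithm.simps by blast
qed

end

text \<open>Indexing by \<open>i\<close> makes \<open>C\<close> one constant for all instances, as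
  the O-notation demands; \<open>param i\<close> stands for the other arguments of the
  ratio.\<close>

theorem theorem1p1:
  fixes P :: "'i \<Rightarrow> ('r, 's) covering"
    and param :: "'i \<Rightarrow> 'p"
    and \<rho> :: "nat \<Rightarrow> 'p \<Rightarrow> real"
    and ALG :: "'i \<Rightarrow> ('w, 'r, 's) algorithm"
  assumes "\<And>i. covering_problem (P i)"
    and "\<And>i. online_algorithm (P i) (ALG i)"
    and "\<And>i. competitive (P i) (ALG i) (\<lambda>X. \<rho> (card X) (param i))"
    and "\<And>i. 1 \<le> \<rho> 0 (param i)"
  shows "\<exists>C>0. \<exists>ALG' :: 'i \<Rightarrow> 'r set \<Rightarrow> ('w, 'r, 's) algorithm.
    \<forall>i Xhat. finite Xhat \<and> Xhat \<subseteq> requests (P i) \<longrightarrow>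
      online_algorithm (P i) (ALG' i Xhat) \<and>
      competitive (P i) (ALG' i Xhat) (\<lambda>X. C * \<rho> (prediction_error X Xhat) (param i)) \<and>
      (deterministic (P i) (ALG i) \<longrightarrow> deterministic (P i) (ALG' i Xhat))"
\<comment> \<open>The constant is 6 * 4: the expected cost is at most 6 budgets, and a budget is at
  most 4 times ratio times optimum.\<close>
proof (intro exI[of _ "24 :: real"] conjI exI[of _ "\<lambda>i. with_prediction (P i) (ALG i)"] allI impI)
  fix i and Xhat :: "'r set"
  assume "finite Xhat \<and> Xhat \<subseteq> requests (P i)"
  then interpret predicted_instance "P i" "ALG i" "\<lambda>n. \<rho> n (param i)" Xhat
    by unfold_locales (use assms in auto)
  show "online_algorithm (P i) (with_prediction (P i) (ALG i) Xhat)"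
    by (rule online_with_prediction)
  show "competitive (P i) (with_prediction (P i) (ALG i) Xhat)
      (\<lambda>X. 24 * \<rho> (prediction_error X Xhat) (param i))"
    by (rule competitive_with_prediction)
  show "deterministic (P i) (with_prediction (P i) (ALG i) Xhat)" if "deterministic (P i) (ALG i)"
    using that by (rule deterministic_with_prediction)
qed simp

end
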